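(* Let $F$, $b$, $\mathcal I$ satisfy assumptions $(\mathcal A_1)$, $(\mathcal A_2)$, $(\mathcal A_3)$ listed in the context. Then for any $\omega\ge 0$ there exists a unique (real) $t_\omega\in[0,t^*]$ for which the problem $F(u)=t_\omega b$ has a solution $u_\omega\in\mathcal K_{t_\omega}$ such that $b^\top u_\omega=\omega$. In addition, the function $\psi\colon\omega\mapsto t_\omega$ is non-decreasing and continuous in $\mathbb R_+=[0,+\infty)$, $\psi(0)=0$, and $\lim_{\omega\to+\infty}\psi(\omega)=t^*$.
   Context: Let $F\colon\mathbb R^n\to\mathbb R^n$ and $b\in\mathbb R^n$; $\|\cdot\|$ is the Euclidean norm. Assumptions: $(\mathcal A_1)$ $b\ne 0$, $F(0)=0$ and $F$ is continuous in $\mathbb R^n$. $(\mathcal A_2)$ There is a convex, continuously differentiable $\mathcal I\colon\mathbb R^n\to\mathbb R$ with $\nabla\mathcal I(v)=F(v)$ for all $v\in\mathbb R^n$ and $\mathcal I(0)=0$. $(\mathcal A_3)$ There exist $c_1>0$, $c_2\ge0$ such that $\mathcal I(v)\ge c_1\|v\|-c_2$ for all $v\in\mathbb R^n$. For $t\ge0$, $\mathcal K_t$ denotes the set of all $u\in\mathbb R^n$ with $F(u)=tb$ (equivalently, the set of minimizers over $\mathbb R^n$ of $\mathcal J_t(v)=\mathcal I(v)-t\,b^\top v$). The value $t^*\in[0,+\infty]$ is the supremum of all $\bar t\ge0$ such that $\mathcal K_t\neq\emptyset$ for every $t\in[0,\bar t\,]$ (the case $t^*=+\infty$ is allowed). 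*)

theory Defs
  imports "HOL-Analysis.Analysis"
begin

definition sol_set :: "(real ^ 'n \<Rightarrow> real ^ 'n) \<Rightarrow> real ^ 'n \<Rightarrow> real \<Rightarrow> (real ^ 'n) set"
  where "sol_set F b t = {u. F u = t *\<^sub>R b}"

(* The value may be infinite, so the supremum is taken in the extended reals. *)
definition t_star :: "(real ^ 'n \<Rightarrow> real ^ 'n) \<Rightarrow> real ^ 'n \<Rightarrow> ereal"
  where "t_star F b = (SUP s \<in> {s. 0 \<le> s \<and> (\<forall>t\<in>{0..s}. sol_set F b t \<noteq> {})}. ereal s)"

definition admissible :: "(real ^ 'n \<Rightarrow> real ^ 'n) \<Rightarrow> real ^ 'n \<Rightarrow> real \<Rightarrow> real \<Rightarrow> bool"
  where "admissible F b w t \<longleftrightarrow>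
    0 \<le> t \<and> ereal t \<le> t_star F b \<and> (\<exists>u \<in> sol_set F b t. b \<bullet> u = w)"

(* Meaningful only where the admissible t exists and is unique, which is asserted
   separately, for every w \<ge> 0. *)
definition psi :: "(real ^ 'n \<Rightarrow> real ^ 'n) \<Rightarrow> real ^ 'n \<Rightarrow> real \<Rightarrow> real"
  where "psi F b w = (THE t. admissible F b w t)"

end

theory Submission
  imports Defs
begin

text \<open>
  Everything follows from minimising the potential \<open>I\<close> on the hyperplanes \<open>b \<bullet> u = \<omega>\<close>.
  Coercivity gives a minimiser \<open>u\<close>, and since \<open>I\<close> has slope \<open>0\<close> at \<open>u\<close> in every direction
  orthogonal to \<open>b\<close>, its gradient \<open>F u\<close> is a multiple \<open>t *\<^sub>R b\<close>: the number \<open>t\<close> is the Lagrange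
  multiplier of the constraint (\<open>solution_with_prescribed_product\<close>). It is nonnegative for
  \<open>\<omega> > 0\<close>, because \<open>t * \<omega> = F u \<bullet> u \<ge> I u \<ge> 0\<close> by convexity.

  The minimiser \<open>u\<close> need not be unique, but its multiplier \<open>t\<close> is. Two solutions \<open>u\<^sub>1\<close>, \<open>u\<^sub>2\<close> on the same
  hyperplane have the same energy, so the tangent plane at \<open>u\<^sub>2\<close> touches the graph of \<open>I\<close> from
  below at \<open>u\<^sub>1\<close> too, and differentiability at \<open>u\<^sub>1\<close> forces the two multipliers to agree
  (\<open>multiplier_unique\<close>).

  If \<open>F u = t *\<^sub>R b\<close> is solvable then so is \<open>F u = s *\<^sub>R b\<close> for all \<open>0 \<le> s \<le> t\<close>
  (\<open>solvable_downward\<close>), since \<open>I v - s * (b \<bullet> v)\<close> is a convex combination of a coercive function and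
  one that is bounded below. Hence solvable multipliers never exceed \<open>t_star\<close>, and the values of
  \<open>\<psi>\<close> form an interval. Monotonicity of the gradient makes \<open>\<psi>\<close> non-decreasing, and a monotone
  function whose values form an interval has no jumps, so it is continuous. Its limit at infinity is
  its supremum, which is \<open>t_star\<close> because every solvable \<open>t > 0\<close> is a value of \<open>\<psi>\<close>.
\<close>

section \<open>Monotone functions whose values form an interval\<close>

text \<open>
  A jump of \<open>f\<close> at \<open>x\<close> would leave a gap among its values. The hypothesis \<open>ivl\<close> provides a value
  strictly inside any putative gap, and monotonicity locates the point where it is taken strictly to
  the right (or left) of \<open>x\<close>, which yields the neighbourhood.
\<close>

lemma mono_on_interval_image_imp_continuous_on:
  fixes f :: "real \<Rightarrow> real"
  assumes mono: "mono_on {a..} f"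
    and ivl: "\<And>x y t. a \<le> x \<Longrightarrow> a \<le> y \<Longrightarrow> f x \<le> t \<Longrightarrow> t \<le> f y \<Longrightarrow> \<exists>z\<ge>a. f z = t"
  shows "continuous_on {a..} f"
  unfolding continuous_on_def
proof (intro ballI order_tendstoI)
  fix x c assume x: "x \<in> {a..}" and c: "f x < c"
  have "\<exists>z>x. f z < c"
  proof (cases "f (x + 1) < c")
    case True
    then show ?thesis by (intro exI[of _ "x + 1"]) auto
  next
    case False
    obtain z where z: "a \<le> z" "f z = (f x + c) / 2"
      using ivl[of x "x + 1" "(f x + c) / 2"] x c False by auto
    then have "\<not> z \<le> x" using mono_onD[OF mono, of z x] x c by auto
    then show ?thesis using z c by (intro exI[of _ z]) auto
  qed
  then obtain z where z: "x < z" "f z < c" by blast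
  have "f y < c" if "y \<in> {a..}" "y < z" for y
    using mono_onD[OF mono, of y z] that x z by auto
  then show "eventually (\<lambda>y. f y < c) (at x within {a..})"
    unfolding eventually_at_topological using z by (intro exI[of _ "{..<z}"]) auto
next
  fix x c assume x: "x \<in> {a..}" and c: "c < f x"
  show "eventually (\<lambda>y. c < f y) (at x within {a..})"
  proof (cases "c < f a")
    case True
    then have "c < f y" if "y \<in> {a..}" for y
      using mono_onD[OF mono, of a y] that by auto
    then show ?thesis unfolding eventually_at_topological by (intro exI[of _ UNIV]) auto
  next
    case False
    then obtain z where z: "a \<le> z" "f z = (f x + c) / 2"
      using ivl[of a x "(f x + c) / 2"] x c by auto
    then have "\<not> x \<le> z" using mono_onD[OF mono, of x z] x c by auto
    moreover have "c < f y" if "y \<in> {a..}" "z < y" for y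
      using mono_onD[OF mono, of z y] that z c by (auto simp: field_simps)
    ultimately show ?thesis
      unfolding eventually_at_topological by (intro exI[of _ "{z<..}"]) auto
  qed
qed

section \<open>Gradients of convex functions\<close>

lemma GDERIV_line:
  assumes "GDERIV f u :> g"
  shows "((\<lambda>s. f (u + s *\<^sub>R h)) has_real_derivative g \<bullet> h) (at 0)"
proof -
  have "((\<lambda>s. f (u + s *\<^sub>R h)) has_derivative (\<lambda>s. (s *\<^sub>R h) \<bullet> g)) (at 0)"
    by (rule has_derivative_compose[where f = "\<lambda>s. u + s *\<^sub>R h" and g = f])
       (use assms in \<open>auto simp: gderiv_def intro!: derivative_eq_intros\<close>)
  moreover have "(\<lambda>s. (s *\<^sub>R h) \<bullet> g) = (*) (g \<bullet> h)"
    by (auto simp: inner_commute)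
  ultimately show ?thesis by (simp add: has_field_derivative_def)
qed

lemma convex_on_gradient_below:
  fixes f :: "'a::real_inner \<Rightarrow> real"
  assumes conv: "convex_on UNIV f" and grad: "GDERIV f u :> g"
  shows "f u + g \<bullet> (v - u) \<le> f v"
proof -
  have "convex_on UNIV (\<lambda>s. f (u + s *\<^sub>R (v - u)))"
  proof (rule convex_onI)
    fix t x y :: real assume t: "0 < t" "t < 1"
    have "u + ((1 - t) *\<^sub>R x + t *\<^sub>R y) *\<^sub>R (v - u)
        = (1 - t) *\<^sub>R (u + x *\<^sub>R (v - u)) + t *\<^sub>R (u + y *\<^sub>R (v - u))"
      by (simp add: algebra_simps)
    then show "f (u + ((1 - t) *\<^sub>R x + t *\<^sub>R y) *\<^sub>R (v - u))
        \<le> (1 - t) * f (u + x *\<^sub>R (v - u)) + t * f (u + y *\<^sub>R (v - u))"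
      using convex_onD[OF conv, of t] t by simp
  qed simp
  from convex_on_imp_above_tangent[OF this _ _ _ GDERIV_line[OF grad], of 1]
  show ?thesis by simp
qed

text \<open>
  A differentiable function that lies above an affine function along a line and touches it at \<open>u\<close>
  has the same slope there. With \<open>c = 0\<close> this is Fermat's rule for a minimum along the line; the
  version with slope \<open>c\<close> also compares two tangent planes.
\<close>

lemma slope_of_touching_affine:
  assumes grad: "GDERIV f u :> g"
    and above: "\<And>s. f u + s * c \<le> f (u + s *\<^sub>R h)"
  shows "g \<bullet> h = c"
proof -
  have "((\<lambda>s. f (u + s *\<^sub>R h) - s * c) has_real_derivative g \<bullet> h - c) (at 0)"
    by (auto intro!: derivative_eq_intros GDERIV_line[OF grad])
  then have "g \<bullet> h - c = 0"
    by (rule DERIV_local_min[of _ _ _ 1]) (use above in \<open>auto simp: algebra_simps\<close>)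
  then show ?thesis by simp
qed

lemma gradient_of_touching_affine:
  fixes g :: "'a::real_inner"
  assumes grad: "GDERIV f u :> g" and above: "\<And>v. f u + a \<bullet> (v - u) \<le> f v"
  shows "g = a"
proof -
  have "g \<bullet> h = a \<bullet> h" for h
  proof (rule slope_of_touching_affine[OF grad])
    show "f u + s * (a \<bullet> h) \<le> f (u + s *\<^sub>R h)" for s
      using above[of "u + s *\<^sub>R h"] by simp
  qed
  then show ?thesis by (metis vector_eq_ldot inner_commute)
qed

lemma coercive_attains_min_on_closed:
  fixes f :: "'a::euclidean_space \<Rightarrow> real"
  assumes cont: "continuous_on UNIV f" and S: "closed S" "S \<noteq> {}"
    and c: "c > 0" and coercive: "\<And>v. c * norm v - d \<le> f v"
  obtains u where "u \<in> S" "\<And>v. v \<in> S \<Longrightarrow> f u \<le> f v"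
proof -
  obtain p where p: "p \<in> S" using S by blast
  define R where "R = (f p + d) / c"
  \<comment> \<open>Outside this ball \<open>f\<close> exceeds its value at the reference point \<open>p\<close>.\<close>
  have out: "norm v \<le> R" if "f v \<le> f p" for v
    using coercive[of v] that c by (simp add: R_def field_simps)
  have "compact (S \<inter> cball 0 R)" using S by (intro closed_Int_compact) auto
  moreover have "p \<in> S \<inter> cball 0 R" using p out by auto
  moreover have "continuous_on (S \<inter> cball 0 R) f" using cont continuous_on_subset by blast
  ultimately obtain u where u: "u \<in> S \<inter> cball 0 R" "\<And>v. v \<in> S \<inter> cball 0 R \<Longrightarrow> f u \<le> f v"
    using continuous_attains_inf[of "S \<inter> cball 0 R" f] by blast
  show thesis
  proof (rule that[of u])
    show "u \<in> S" using u by blast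
    show "f u \<le> f v" if "v \<in> S" for v
    proof (cases "f v \<le> f p")
      case True
      then show ?thesis using u(2)[of v] that out by auto
    next
      case False
      then show ?thesis using u(2)[of p] p out by fastforce
    qed
  qed
qed

section \<open>Multipliers and prescribed products\<close>

locale coercive_convex_potential =
  fixes F :: "'a::euclidean_space \<Rightarrow> 'a" and I :: "'a \<Rightarrow> real" and c d :: real
  assumes convex: "convex_on UNIV I"
    and gradient: "\<And>v. GDERIV I v :> F v"
    and F_zero: "F 0 = 0" and I_zero: "I 0 = 0"
    and c_pos: "c > 0" and coercive: "\<And>v. c * norm v - d \<le> I v"
begin

lemma above_tangent: "I u + F u \<bullet> (v - u) \<le> I v"
  by (rule convex_on_gradient_below[OF convex gradient])

lemma continuous_potential: "continuous_on UNIV I"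
  using gradient has_derivative_continuous
  by (fastforce simp: gderiv_def continuous_on_eq_continuous_at)

lemma potential_nonneg: "0 \<le> I v"
  using above_tangent[of 0 v] by (simp add: F_zero I_zero)

lemma multiplier_times_product_nonneg:
  assumes "F u = t *\<^sub>R b"
  shows "0 \<le> t * (b \<bullet> u)"
  using above_tangent[of u 0] potential_nonneg[of u] assms by (simp add: I_zero)

text \<open>The monotonicity of the gradient of a convex function, read along \<open>b\<close>.\<close>

lemma multiplier_mono:
  assumes "F u = t *\<^sub>R b" "F v = s *\<^sub>R b" "b \<bullet> u < b \<bullet> v"
  shows "t \<le> s"
proof -
  have "t * (b \<bullet> v - b \<bullet> u) \<le> s * (b \<bullet> v - b \<bullet> u)"
    using above_tangent[of u v] above_tangent[of v u] assms
    by (simp add: inner_diff_right algebra_simps)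
  then show ?thesis using assms(3) by simp
qed

text \<open>
  Both points minimise \<open>I\<close> on their common hyperplane, so \<open>I u = I v\<close>. The tangent plane at \<open>v\<close>
  then also passes through the point of the graph above \<open>u\<close>.
\<close>

lemma multiplier_unique:
  assumes b: "b \<noteq> 0" and u: "F u = t *\<^sub>R b" and v: "F v = s *\<^sub>R b" and eq: "b \<bullet> u = b \<bullet> v"
  shows "t = s"
proof -
  have "I u = I v"
    using above_tangent[of u v] above_tangent[of v u] u v eq by (simp add: inner_diff_right)
  then have "I u + (s *\<^sub>R b) \<bullet> (w - u) \<le> I w" for w
    using above_tangent[of v w] v eq by (simp add: inner_diff_right)
  then have "F u = s *\<^sub>R b" by (rule gradient_of_touching_affine[OF gradient])
  then show ?thesis using u b by simp
qed

lemma solution_with_prescribed_product: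
  assumes b: "b \<noteq> 0"
  obtains t u where "F u = t *\<^sub>R b" "b \<bullet> u = w"
proof -
  define S where "S = {u. b \<bullet> u = w}"
  have "(w / (b \<bullet> b)) *\<^sub>R b \<in> S" using b by (simp add: S_def)
  moreover have "closed S" unfolding S_def by (rule closed_hyperplane)
  ultimately obtain u where u: "u \<in> S" "\<And>v. v \<in> S \<Longrightarrow> I u \<le> I v"
    using coercive_attains_min_on_closed[OF continuous_potential _ _ c_pos coercive, of S] by blast
  have orth: "F u \<bullet> h = 0" if "b \<bullet> h = 0" for h
  proof (rule slope_of_touching_affine[OF gradient])
    show "I u + s * 0 \<le> I (u + s *\<^sub>R h)" for s
      using u that by (simp add: S_def inner_add_right)
  qed
  define t where "t = (b \<bullet> F u) / (b \<bullet> b)"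
  \<comment> \<open>The component of \<open>F u\<close> orthogonal to \<open>b\<close> is itself a direction in which the slope vanishes.\<close>
  define h where "h = F u - t *\<^sub>R b"
  have bh: "b \<bullet> h = 0" using b by (simp add: h_def t_def inner_diff_right)
  have "h \<bullet> h = (F u - t *\<^sub>R b) \<bullet> h" by (simp only: h_def)
  also have "\<dots> = 0" using orth[OF bh] bh by (simp add: inner_diff_left)
  finally have "h = 0" by simp
  then show thesis using u that[of u t] by (simp add: h_def S_def)
qed

lemma solvable_downward:
  assumes u: "F u = t *\<^sub>R b" and s: "0 \<le> s" "s \<le> t"
  obtains v where "F v = s *\<^sub>R b"
proof (cases "s = t")
  case True
  then show thesis using u that by blast
next
  case False
  define q where "q = s / t"
  have q: "0 \<le> q" "q < 1" "q * t = s" using s False by (auto simp: q_def)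
  define J where "J v = I v - s * (b \<bullet> v)" for v
  define m where "m = I u - t * (b \<bullet> u)"
  have m: "m \<le> I v - t * (b \<bullet> v)" for v
    using above_tangent[of u v] u by (simp add: m_def inner_diff_right algebra_simps)
  have "(1 - q) * c * norm v - ((1 - q) * d - q * m) \<le> J v" for v
  proof -
    have "J v = (1 - q) * I v + q * (I v - t * (b \<bullet> v))"
      by (simp add: J_def algebra_simps flip: q(3))
    moreover have "(1 - q) * (c * norm v - d) \<le> (1 - q) * I v"
      using q coercive by (intro mult_left_mono) auto
    moreover have "q * m \<le> q * (I v - t * (b \<bullet> v))"
      using q m by (intro mult_left_mono) auto
    ultimately show ?thesis by (simp add: algebra_simps)
  qed
  moreover have "continuous_on UNIV J"
    unfolding J_def by (intro continuous_intros continuous_potential)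
  moreover have "0 < (1 - q) * c" using q c_pos by simp
  ultimately obtain v where v: "\<And>w. J v \<le> J w"
    using coercive_attains_min_on_closed[of J UNIV] by (metis UNIV_I UNIV_not_empty closed_UNIV)
  have "I v + (s *\<^sub>R b) \<bullet> (w - v) \<le> I w" for w
    using v[of w] by (simp add: J_def inner_diff_right algebra_simps)
  then show thesis using that gradient_of_touching_affine[OF gradient] by blast
qed

end

section \<open>The multiplier as a function of the prescribed product\<close>

theorem theorem3p3:
  fixes F :: "real ^ 'n \<Rightarrow> real ^ 'n" and b :: "real ^ 'n" and I :: "real ^ 'n \<Rightarrow> real"
  assumes A1: "b \<noteq> 0" "F 0 = 0" "continuous_on UNIV F"
    and A2: "convex_on UNIV I" "\<And>v. GDERIV I v :> F v" "I 0 = 0"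
    and A3: "\<exists>c1 c2. c1 > 0 \<and> c2 \<ge> 0 \<and> (\<forall>v. I v \<ge> c1 * norm v - c2)"
  shows "(\<forall>\<omega>\<ge>0. \<exists>!t. admissible F b \<omega> t)
    \<and> mono_on {0..} (psi F b)
    \<and> continuous_on {0..} (psi F b)
    \<and> psi F b 0 = 0
    \<and> ((\<lambda>\<omega>. ereal (psi F b \<omega>)) \<longlongrightarrow> t_star F b) at_top"
proof -
  obtain c d where "c > 0" "\<forall>v. c * norm v - d \<le> I v" using A3 by blast
  then interpret coercive_convex_potential F I c d
    using A1 A2 by unfold_locales auto
  have le_t_star: "ereal t \<le> t_star F b" if "F u = t *\<^sub>R b" "0 \<le> t" for t u
    unfolding t_star_def
  proof (rule SUP_upper, clarsimp, intro conjI ballI)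
    show "0 \<le> t" by fact
    show "sol_set F b s \<noteq> {}" if "s \<in> {0..t}" for s
      using solvable_downward[OF \<open>F u = t *\<^sub>R b\<close>, of s] that by (auto simp: sol_set_def)
  qed
  have admissible: "admissible F b (b \<bullet> u) t" if "F u = t *\<^sub>R b" "0 \<le> t" for t u
    using that le_t_star[OF that] by (auto simp: admissible_def sol_set_def)
  have unique: "t = s" if "admissible F b w t" "admissible F b w s" for w t s
    using that multiplier_unique[OF A1(1)] by (auto simp: admissible_def sol_set_def)
  have zero: "admissible F b 0 0"
    using admissible[of 0 0] F_zero by simp
  have ex: "\<exists>t. admissible F b w t" if "0 \<le> w" for w
  proof (cases "w = 0")
    case False
    obtain t u where u: "F u = t *\<^sub>R b" "b \<bullet> u = w"
      by (rule solution_with_prescribed_product[OF A1(1)])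
    then have "0 \<le> t"
      using multiplier_times_product_nonneg[of u t b] False that by (simp add: zero_le_mult_iff)
    then show ?thesis using admissible[OF u(1)] u(2) by auto
  qed (use zero in auto)
  have psi_eq: "psi F b w = t" if "admissible F b w t" for w t
    unfolding psi_def using that unique by (intro the_equality) auto
  have psi: "admissible F b w (psi F b w)" if "0 \<le> w" for w
    using ex[OF that] psi_eq by auto
  have psi_zero: "psi F b 0 = 0" by (rule psi_eq[OF zero])
  have attained: "\<exists>w\<ge>0. psi F b w = t" if "F u = t *\<^sub>R b" "0 \<le> t" for t u
  proof (cases "t = 0")
    case True
    \<comment> \<open>The product with \<open>b\<close> of a solution for \<open>t = 0\<close> may be negative, so \<open>u\<close> itself is no witness.\<close>
    then show ?thesis using psi_zero by auto
  next
    case False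
    then have "0 \<le> b \<bullet> u"
      using multiplier_times_product_nonneg[OF that(1)] that(2) by (simp add: zero_le_mult_iff)
    then show ?thesis using psi_eq[OF admissible[OF that]] by blast
  qed
  have mono: "mono_on {0..} (psi F b)"
  proof (rule mono_onI)
    fix x y :: real assume xy: "x \<in> {0..}" "y \<in> {0..}" "x \<le> y"
    then obtain u v where "F u = psi F b x *\<^sub>R b" "b \<bullet> u = x" "F v = psi F b y *\<^sub>R b" "b \<bullet> v = y"
      using psi[of x] psi[of y] by (auto simp: admissible_def sol_set_def)
    then show "psi F b x \<le> psi F b y"
      using multiplier_mono[of u _ b v] xy by (cases "x = y") auto
  qed
  have cont: "continuous_on {0..} (psi F b)"
  proof (rule mono_on_interval_image_imp_continuous_on[OF mono])
    fix x y t :: real assume "0 \<le> x" "0 \<le> y" and t: "psi F b x \<le> t" "t \<le> psi F b y"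
    then obtain u where "0 \<le> t" "F u = psi F b y *\<^sub>R b"
      using psi[of x] psi[of y] by (auto simp: admissible_def sol_set_def)
    then show "\<exists>z\<ge>0. psi F b z = t"
      using solvable_downward[of u _ b t] t attained by metis
  qed
  have lim: "((\<lambda>w. ereal (psi F b w)) \<longlongrightarrow> t_star F b) at_top"
  proof (rule order_tendstoI)
    fix a assume "a < t_star F b"
    then obtain s where s: "a < ereal s" "0 \<le> s" "sol_set F b s \<noteq> {}"
      by (auto simp: t_star_def less_SUP_iff)
    then obtain w where w: "0 \<le> w" "psi F b w = s"
      using attained by (auto simp: sol_set_def)
    have "a < ereal (psi F b x)" if "w \<le> x" for x
      using mono_onD[OF mono, of w x] that w s(1) by (auto intro: less_le_trans)
    then show "eventually (\<lambda>w. a < ereal (psi F b w)) at_top"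
      by (auto simp: eventually_at_top_linorder)
  next
    fix a assume a: "t_star F b < a"
    have "ereal (psi F b x) < a" if "0 \<le> x" for x
      using psi[OF that] a by (auto simp: admissible_def)
    then show "eventually (\<lambda>w. ereal (psi F b w) < a) at_top"
      by (auto simp: eventually_at_top_linorder)
  qed
  show ?thesis
    using ex unique mono cont psi_zero lim by blast
qed

end
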